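(* Let $n\ge 1$, let $l=\lfloor n/2\rfloor$, let $J_n$ be an $n\times n$ complex irreducible tridiagonal matrix with zero main diagonal, with subdiagonal entries $a_1,\dots,a_{n-1}\in\mathbb{C}\setminus\{0\}$ and superdiagonal entries $c_1,\dots,c_{n-1}\in\mathbb{C}\setminus\{0\}$. Let $x\in\mathbb{C}\setminus\{0\}$ and $A_n=J_n+xE_n$, where $E_n=\mathrm{diag}(1,-1,1,\dots,(-1)^{n-1})$. Let $\lambda_1,\dots,\lambda_l\in\mathbb{C}$ be such that, as multisets (eigenvalues listed with algebraic multiplicity), $\sigma(J_n)=\{\pm\lambda_1,\dots,\pm\lambda_l\}$ if $n=2l$, and $\sigma(J_n)=\{0,\pm\lambda_1,\dots,\pm\lambda_l\}$ if $n=2l+1$. Then $$\det A_{2l}=(-1)^l\prod_{k=1}^{l}\left(x^2+\lambda_k^2\right)\ \text{ if } n=2l,\qquad \det A_{2l+1}=(-1)^l x\prod_{k=1}^{l}\left(x^2+\lambda_k^2\right)\ \text{ if } n=2l+1,$$ where some of the numbers $\lambda_k$ in the second product can be zero.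
   Context: $J_n$ has entries $(J_n)_{k+1,k}=a_k$, $(J_n)_{k,k+1}=c_k$ for $k=1,\dots,n-1$, and all other entries zero. The spectrum $\sigma(M)$ of a matrix $M$ is the multiset of its eigenvalues, each appearing as many times as its algebraic multiplicity. The spectrum of $J_n$ always admits the listing used in the claim (it is symmetric with respect to $0$); the numbers $\lambda_i$ need not be distinct. *)

theory Defs
  imports "Jordan_Normal_Form.Char_Poly"
begin

(* The diagonals are indexed from 1, as a_1, ..., a_{n-1} and c_1, ..., c_{n-1}, whereas
   matrix positions start at (0,0): the entry a_k sits at (k,k-1) and c_k at (k-1,k). *)
definition tridiag0 :: "nat \<Rightarrow> (nat \<Rightarrow> complex) \<Rightarrow> (nat \<Rightarrow> complex) \<Rightarrow> complex mat" where
  "tridiag0 n a c = Matrix.mat n n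
     (\<lambda>(i, j). if i = Suc j then a i else if j = Suc i then c j else 0)"

definition alt_diag :: "nat \<Rightarrow> complex mat" where
  "alt_diag n = mat_diag n (\<lambda>i. (- 1) ^ i)"

(* The multiplicity of an eigenvalue in this multiset is its order as a root of the
   characteristic polynomial, that is, its algebraic multiplicity. *)
definition spectrum_mset :: "complex mat \<Rightarrow> complex multiset" where
  "spectrum_mset M = proots (char_poly M)"

definition plus_minus :: "nat \<Rightarrow> (nat \<Rightarrow> complex) \<Rightarrow> complex multiset" where
  "plus_minus l lam = (\<Sum>k\<in>{1..l}. {#lam k, - lam k#})"

end

theory Submission
  imports Defs
begin

text \<open>
  With \<open>D = diag(1, \<i>, 1, \<i>, \<dots>)\<close> one has
  \<open>D A D = x I + \<i> J = -\<i> (\<i> x I - J)\<close>, since \<open>D\<^sup>2 = E\<close> and neighbouring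
  diagonal entries of \<open>D\<close> multiply to \<open>\<i>\<close>. Taking determinants, \<open>det A\<close> is, up to
  a power of \<open>\<i>\<close>, the value of the characteristic polynomial of \<open>J\<close> at \<open>\<i> x\<close>,
  where each pair \<open>\<plusminus>\<lambda>\<close> contributes the factor
  \<open>(\<i> x - \<lambda>) (\<i> x + \<lambda>) = -(x\<^sup>2 + \<lambda>\<^sup>2)\<close>.
\<close>

lemma tridiag0_carrier [simp]: "tridiag0 n a c \<in> carrier_mat n n"
  by (simp add: tridiag0_def)

lemma det_mat_diag:
  fixes f :: "nat \<Rightarrow> 'a :: comm_ring_1"
  shows "det (mat_diag n f) = (\<Prod>i<n. f i)"
proof -
  have "det (mat_diag n f) = prod_list (diag_mat (mat_diag n f))"
    by (rule det_upper_triangular[of _ n]) (auto simp: upper_triangular_def mat_diag_def)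
  also have "diag_mat (mat_diag n f) = map f [0..<n]"
    by (auto simp: diag_mat_def mat_diag_def)
  also have "prod_list \<dots> = (\<Prod>i<n. f i)"
    by (simp add: prod.list_conv_set_nth atLeast0LessThan)
  finally show ?thesis .
qed

text \<open>Over the complex numbers the characteristic polynomial splits into monic linear factors,
  and the list of their roots is exactly the spectrum with multiplicities.\<close>

lemma poly_char_poly_eq_prod_spectrum:
  assumes "A \<in> carrier_mat n n"
  shows "poly (char_poly A) z = (\<Prod>r\<in>#spectrum_mset A. z - r)"
proof -
  obtain as where as: "char_poly A = (\<Prod>a\<leftarrow>as. [:- a, 1:])"
    using char_poly_factorized[OF assms] by blast
  have "proots (\<Prod>a\<leftarrow>as. [:- a, 1:]) = mset as"
  proof (induction as)
    case (Cons b bs)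
    \<comment> \<open>\<open>proots\<close> turns products into sums only for nonzero factors, since
      \<open>proots 0\<close> is empty.\<close>
    have "(\<Prod>a\<leftarrow>bs. [:- a, 1:]) \<noteq> 0"
      by (auto simp: prod_list_zero_iff)
    then show ?case
      using Cons by (simp add: proots_mult del: mult_pCons_left)
  qed simp
  then have "spectrum_mset A = mset as"
    by (simp add: spectrum_mset_def as)
  moreover have "poly (\<Prod>a\<leftarrow>as. [:- a, 1:]) z = (\<Prod>a\<leftarrow>as. z - a)"
    by (induction as) (simp_all add: algebra_simps)
  ultimately show ?thesis
    by (simp add: as flip: prod_mset_prod_list)
qed

lemma prod_plus_minus:
  "(\<Prod>r\<in>#plus_minus l lam. \<i> * x - r) = (- 1) ^ l * (\<Prod>k\<in>{1..l}. x\<^sup>2 + (lam k)\<^sup>2)"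
proof (induction l)
  case (Suc l)
  have factor: "(\<i> * x - u) * (\<i> * x + u) = - (x\<^sup>2 + u\<^sup>2)" for u
    by (simp add: algebra_simps power2_eq_square)
  have "plus_minus (Suc l) lam = plus_minus l lam + {#lam (Suc l), - lam (Suc l)#}"
    by (simp add: plus_minus_def)
  then have "(\<Prod>r\<in>#plus_minus (Suc l) lam. \<i> * x - r) =
      (\<Prod>r\<in>#plus_minus l lam. \<i> * x - r) * ((\<i> * x - lam (Suc l)) * (\<i> * x + lam (Suc l)))"
    by (simp add: mult_ac)
  then show ?case
    unfolding factor Suc.IH by (simp add: algebra_simps)
qed (simp add: plus_minus_def)

text \<open>One formula covers both parities: \<open>(- \<i>) ^ n\<close> comes from pulling a
  scalar out of a determinant of size \<open>n\<close>, and \<open>(- 1) ^ (n div 2)\<close> is the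
  square of det D, a sign and hence its own inverse.\<close>

lemma det_tridiag0_add_alt_diag:
  "det (tridiag0 n a c + x \<cdot>\<^sub>m alt_diag n) =
     (- 1) ^ (n div 2) * (- \<i>) ^ n * poly (char_poly (tridiag0 n a c)) (\<i> * x)"
proof -
  define f :: "nat \<Rightarrow> complex" where "f i = (if even i then 1 else \<i>)" for i
  define A where "A = tridiag0 n a c + x \<cdot>\<^sub>m alt_diag n"
  \<comment> \<open>\<open>char_matrix M e\<close> is M - e I; the negation gives \<i> x I - J,
    whose determinant is the characteristic polynomial of J at \<i> x.\<close>
  define B where "B = - char_matrix (tridiag0 n a c) (\<i> * x)"
  have A: "A \<in> carrier_mat n n" and B: "B \<in> carrier_mat n n"
    by (auto simp: A_def B_def char_matrix_def tridiag0_def alt_diag_def mat_diag_def)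
  have "mat_diag n f * A * mat_diag n f = (- \<i>) \<cdot>\<^sub>m B"
    by (subst mat_diag_mult_left[OF A], subst mat_diag_mult_right[of _ n n])
      (use A B in \<open>auto intro!: eq_matI simp: A_def B_def f_def char_matrix_def
        tridiag0_def alt_diag_def mat_diag_def mult.commute[of _ \<i>]\<close>)
  then have "det (mat_diag n f) * det A * det (mat_diag n f) = (- \<i>) ^ n * det B"
    using A B by (metis det_mult det_smult carrier_matD(2) mat_diag_dim mult_carrier_mat)
  moreover have "det (mat_diag n f) * det (mat_diag n f) = (- 1) ^ (n div 2)"
  proof -
    \<comment> \<open>The factor is -1 exactly at odd indices, and there are \<open>n div 2\<close>
      of these below \<open>n\<close>.\<close>
    have "(\<Prod>i<n. f i * f i) = (- 1) ^ (n div 2)"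
      by (induction n) (auto simp: f_def div_Suc elim!: evenE oddE)
    then show ?thesis
      by (simp add: det_mat_diag prod.distrib)
  qed
  ultimately have "(- 1) ^ (n div 2) * det A = (- \<i>) ^ n * det B"
    by (simp add: mult_ac)
  then have "det A = (- 1) ^ (n div 2) * ((- \<i>) ^ n * det B)"
    by (metis (no_types, lifting) left_minus_one_mult_self)
  then show ?thesis
    by (simp add: char_poly_matrix[of _ n] A_def B_def mult.assoc)
qed

text \<open>Serves the existence claim: 3 is the smallest odd size with a pair of eigenvalues
  besides the obligatory 0, and that pair is zero exactly when \<open>a 1 * c 1 + a 2 * c 2\<close>
  vanishes.\<close>

lemma char_poly_tridiag0_3:
  "char_poly (tridiag0 3 a c) = [:0, - (a 1 * c 1 + a 2 * c 2), 0, 1:]"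
proof -
  have det3: "det M = M $$ (0,0) * (M $$ (1,1) * M $$ (2,2) - M $$ (1,2) * M $$ (2,1))
      - M $$ (0,1) * (M $$ (1,0) * M $$ (2,2) - M $$ (1,2) * M $$ (2,0))
      + M $$ (0,2) * (M $$ (1,0) * M $$ (2,1) - M $$ (1,1) * M $$ (2,0))"
    if M: "M \<in> carrier_mat 3 3" for M :: "complex poly mat"
  proof -
    have det2: "det N = N $$ (0,0) * N $$ (1,1) - N $$ (0,1) * N $$ (1,0)"
      if N: "N \<in> carrier_mat 2 2" for N :: "complex poly mat"
      using N mat_delete_carrier[OF N]
      by (simp add: laplace_expansion_row[OF N, of 0] cofactor_def det_single
          numeral_2_eq_2 mat_delete_def)
    show ?thesis
      using M mat_delete_carrier[OF M]
      by (simp add: laplace_expansion_row[OF M, of 0] cofactor_def det2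
          eval_nat_numeral mat_delete_def algebra_simps)
  qed
  show ?thesis
    unfolding char_poly_def
    by (subst det3) (auto simp: char_poly_matrix_def tridiag0_def algebra_simps)
qed

theorem corollary3p2:
  shows "(\<forall>(n::nat) (l::nat) (a::nat \<Rightarrow> complex) (c::nat \<Rightarrow> complex) (x::complex) (lam::nat \<Rightarrow> complex).
            n \<ge> 1 \<longrightarrow> l = n div 2 \<longrightarrow>
            (\<forall>k\<in>{1..<n}. a k \<noteq> 0 \<and> c k \<noteq> 0) \<longrightarrow> x \<noteq> 0 \<longrightarrow>
            (n = 2 * l \<longrightarrow> spectrum_mset (tridiag0 n a c) = plus_minus l lam) \<longrightarrow>
            (n = 2 * l + 1 \<longrightarrow> spectrum_mset (tridiag0 n a c) = {#0#} + plus_minus l lam) \<longrightarrow>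
            (n = 2 * l \<longrightarrow>
               det (tridiag0 n a c + x \<cdot>\<^sub>m alt_diag n)
                 = (- 1) ^ l * (\<Prod>k\<in>{1..l}. x\<^sup>2 + (lam k)\<^sup>2)) \<and>
            (n = 2 * l + 1 \<longrightarrow>
               det (tridiag0 n a c + x \<cdot>\<^sub>m alt_diag n)
                 = (- 1) ^ l * x * (\<Prod>k\<in>{1..l}. x\<^sup>2 + (lam k)\<^sup>2)))
       \<and> (\<exists>(n::nat) (l::nat) (a::nat \<Rightarrow> complex) (c::nat \<Rightarrow> complex) (lam::nat \<Rightarrow> complex).
            n = 2 * l + 1 \<and> (\<forall>k\<in>{1..<n}. a k \<noteq> 0 \<and> c k \<noteq> 0) \<and>
            spectrum_mset (tridiag0 n a c) = {#0#} + plus_minus l lam \<and>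
            (\<exists>k\<in>{1..l}. lam k = 0))"
proof (intro conjI allI impI)
  fix n l :: nat and a c :: "nat \<Rightarrow> complex" and x :: complex and lam :: "nat \<Rightarrow> complex"
  assume "n = 2 * l \<longrightarrow> spectrum_mset (tridiag0 n a c) = plus_minus l lam" and "n = 2 * l"
  \<comment> \<open>Here \<open>(- \<i>) ^ (2 * l)\<close> equals \<open>(- 1) ^ l\<close> and
    cancels the sign from det D, so the remaining \<open>(- 1) ^ l\<close> comes from the l
    eigenvalue pairs.\<close>
  then show "det (tridiag0 n a c + x \<cdot>\<^sub>m alt_diag n) =
      (- 1) ^ l * (\<Prod>k\<in>{1..l}. x\<^sup>2 + (lam k)\<^sup>2)"
    by (simp add: det_tridiag0_add_alt_diag poly_char_poly_eq_prod_spectrum[of _ n]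
        prod_plus_minus power_mult)
next
  fix n l :: nat and a c :: "nat \<Rightarrow> complex" and x :: complex and lam :: "nat \<Rightarrow> complex"
  assume "n = 2 * l + 1 \<longrightarrow> spectrum_mset (tridiag0 n a c) = {#0#} + plus_minus l lam"
    and "n = 2 * l + 1"
  \<comment> \<open>The leftover -\<i> meets the factor \<i> x contributed by the eigenvalue 0, and
    together they give x.\<close>
  moreover have "(- 1) ^ l * (- \<i>) ^ (2 * l + 1) = - \<i>"
    by (simp add: power_mult)
  ultimately have "det (tridiag0 n a c + x \<cdot>\<^sub>m alt_diag n) =
      - \<i> * (\<i> * x * ((- 1) ^ l * (\<Prod>k\<in>{1..l}. x\<^sup>2 + (lam k)\<^sup>2)))"
    by (simp add: det_tridiag0_add_alt_diag poly_char_poly_eq_prod_spectrum[of _ n]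
        prod_plus_minus del: power_Suc)
  then show "det (tridiag0 n a c + x \<cdot>\<^sub>m alt_diag n) =
      (- 1) ^ l * x * (\<Prod>k\<in>{1..l}. x\<^sup>2 + (lam k)\<^sup>2)"
    by (simp flip: mult.assoc)
next
  \<comment> \<open>With all \<open>a k\<close> equal to 1, the values 1 and -1 make
    \<open>a 1 * c 1 + a 2 * c 2\<close> zero, so the matrix is irreducible yet nilpotent: its
    spectrum is 0 three times, read as 0 together with one pair of zeros.\<close>
  define c :: "nat \<Rightarrow> complex" where "c k = (if k = 1 then 1 else - 1)" for k
  have "char_poly (tridiag0 3 (\<lambda>_. 1) c) = [:0, 1:] ^ 3"
    by (simp add: char_poly_tridiag0_3 c_def power3_eq_cube)
  then have "spectrum_mset (tridiag0 3 (\<lambda>_. 1) c) = {#0#} + plus_minus 1 (\<lambda>_. 0)"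
    unfolding spectrum_mset_def by (simp only: proots_power) (simp add: plus_minus_def numeral_3_eq_3)
  then show "\<exists>n l a c lam. n = 2 * l + 1 \<and> (\<forall>k\<in>{1..<n}. a k \<noteq> 0 \<and> c k \<noteq> 0) \<and>
      spectrum_mset (tridiag0 n a c) = {#0#} + plus_minus l lam \<and> (\<exists>k\<in>{1..l}. lam k = 0)"
    by (intro exI[of _ 3] exI[of _ 1] exI[of _ "\<lambda>_. 1"] exI[of _ c] exI[of _ "\<lambda>_. 0"])
      (simp add: c_def)
qed

end
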